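(* For a positive random variable $X$ with $\mathsf{E}X$ and $\mathsf{E}\ln X$ finite, put $A_X:=\mathsf{E}X$ and $G_X:=\exp\mathsf{E}\ln X$. Then $X/G_X\to1$ in probability as $A_X/G_X\downarrow1$. That is, for every $\varepsilon>0$ and every $\eta>0$ there is $\delta>0$ such that for every positive random variable $X$ with finite $\mathsf{E}X$ and $\mathsf{E}\ln X$ and with $1<A_X/G_X<1+\delta$ one has $$\mathsf{P}\Big(\Big|\frac{X}{G_X}-1\Big|\ge\varepsilon\Big)\le\eta .$$
   Context: $A_X$ and $G_X$ are the arithmetic and geometric means of $X$; $\mathsf{P}$ and $\mathsf{E}$ denote probability and expectation; "positive" means taking values in $(0,\infty)$. *)

theory Defs
  imports "HOL-Probability.Probability"
begin

definition positive_rv :: "'a measure \<Rightarrow> ('a \<Rightarrow> real) \<Rightarrow> bool" where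
  "positive_rv M X \<longleftrightarrow> X \<in> borel_measurable M \<and> (\<forall>\<omega>\<in>space M. 0 < X \<omega>)"

definition arith_mean :: "'a measure \<Rightarrow> ('a \<Rightarrow> real) \<Rightarrow> real" where
  "arith_mean M X = integral\<^sup>L M X"

definition geom_mean :: "'a measure \<Rightarrow> ('a \<Rightarrow> real) \<Rightarrow> real" where
  "geom_mean M X = exp (integral\<^sup>L M (\<lambda>\<omega>. ln (X \<omega>)))"

text \<open>
  \<open>admissible_delta TYPE('a) \<epsilon> \<eta> \<delta>\<close>: the number \<open>\<delta>\<close> works, for the given \<open>\<epsilon>\<close> and \<open>\<eta>\<close>, simultaneously for
  all positive random variables on all probability spaces whose sample space lies in the type \<open>'a\<close>.

  HOL cannot quantify over \<open>'a\<close> inside a formula, so a statement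
  \<open>\<exists>\<delta>>0. admissible_delta TYPE('a) \<epsilon> \<eta> \<delta>\<close> would let \<open>\<delta>\<close> depend on \<open>'a\<close>. To express one \<open>\<delta>\<close> for all
  sample spaces, assert that some \<open>\<delta> > 0\<close> is admissible for one fixed type (\<open>real\<close>), and
  that every such \<open>\<delta>\<close> is admissible for an arbitrary type \<open>'a\<close>.
\<close>

definition admissible_delta :: "'a itself \<Rightarrow> real \<Rightarrow> real \<Rightarrow> real \<Rightarrow> bool" where
  "admissible_delta (T :: 'a itself) \<epsilon> \<eta> \<delta> \<longleftrightarrow>
     (\<forall>(M :: 'a measure) (X :: 'a \<Rightarrow> real).
        prob_space M \<and> positive_rv M X \<and>
        integrable M X \<and> integrable M (\<lambda>\<omega>. ln (X \<omega>)) \<and>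
        1 < arith_mean M X / geom_mean M X \<and>
        arith_mean M X / geom_mean M X < 1 + \<delta> \<longrightarrow>
        measure M {\<omega> \<in> space M. \<bar>X \<omega> / geom_mean M X - 1\<bar> \<ge> \<epsilon>} \<le> \<eta>)"

end

(* For y > 0 one has y - 1 - ln y \<ge> (sqrt y - 1)^2, and Y = X/G has E ln Y = 0, so
   E (sqrt Y - 1)^2 \<le> A/G - 1; Markov's inequality bounds the probability of a deviation by a
   quantity not depending on the space. Passing to the distribution of X, a measure on the reals,
   reduces any sample space to the real line. *)

theory Submission
  imports Defs
begin

text \<open>Apply ln t \<le> t - 1 at t = sqrt y and double it: the remainder y - 1 - 2 (sqrt y - 1)
  is a perfect square.\<close>

lemma sqrt_deviation_le:
  fixes y :: real
  assumes "0 < y"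
  shows "(sqrt y - 1)\<^sup>2 \<le> y - 1 - ln y"
proof -
  have "ln y = 2 * ln (sqrt y)"
    using assms by (simp add: ln_sqrt)
  moreover have "ln (sqrt y) \<le> sqrt y - 1"
    using assms by (intro ln_le_minus_one) simp
  moreover have "(sqrt y - 1)\<^sup>2 = y + 1 - 2 * sqrt y"
    using assms by (simp add: power2_diff)
  ultimately show ?thesis
    by linarith
qed

text \<open>By concavity of sqrt, an upward deviation from 1 is compressed more than a downward one,
  so y = 1 + \<epsilon> is the extremal case. With \<open>s\<close> = |sqrt y - 1|, sqrt y \<le> s +
  1 gives |y - 1| \<le> s (s + 2) = (s + 1)^2 - 1, which is then solved for
  \<open>s\<close>.\<close>

lemma sqrt_deviation_ge:
  fixes y \<epsilon> :: real
  assumes "0 < y" "0 < \<epsilon>" "\<epsilon> \<le> \<bar>y - 1\<bar>"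
  shows "(sqrt (1 + \<epsilon>) - 1)\<^sup>2 \<le> (sqrt y - 1)\<^sup>2"
proof -
  define s where "s = \<bar>sqrt y - 1\<bar>"
  have "y - 1 = (sqrt y - 1) * (sqrt y + 1)"
    using assms(1) by (simp add: algebra_simps)
  then have "\<bar>y - 1\<bar> = s * (sqrt y + 1)"
    using assms(1) by (simp add: s_def abs_mult)
  also have "\<dots> \<le> s * (s + 2)"
    by (intro mult_left_mono) (auto simp: s_def)
  finally have "1 + \<epsilon> \<le> (s + 1)\<^sup>2"
    using assms(3) by (simp add: power2_eq_square algebra_simps)
  then have "sqrt (1 + \<epsilon>) \<le> s + 1"
    by (intro real_le_lsqrt) (auto simp: s_def)
  then have "(sqrt (1 + \<epsilon>) - 1)\<^sup>2 \<le> s\<^sup>2"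
    using assms(2) by (intro power_mono) auto
  then show ?thesis
    by (simp add: s_def)
qed

lemma (in prob_space) prob_deviation_geom_mean_le:
  assumes X: "positive_rv M X" "integrable M X" "integrable M (\<lambda>\<omega>. ln (X \<omega>))"
    and \<epsilon>: "0 < \<epsilon>"
  shows "prob {\<omega> \<in> space M. \<epsilon> \<le> \<bar>X \<omega> / geom_mean M X - 1\<bar>}
    \<le> (arith_mean M X / geom_mean M X - 1) / (sqrt (1 + \<epsilon>) - 1)\<^sup>2"
proof -
  define G where "G = geom_mean M X"
  define c where "c = (sqrt (1 + \<epsilon>) - 1)\<^sup>2"
  \<comment> \<open>This is Y - 1 - ln Y for Y = X / G, with the logarithm split so that
    integrability and expectation follow by linearity. Markov's inequality is applied to
    \<open>f\<close> itself, whose mean is known exactly, and not to the smaller (sqrt Y -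
    1)^2.\<close>
  define f where "f \<omega> = X \<omega> / G - 1 - (ln (X \<omega>) - ln G)" for \<omega>
  have G: "0 < G" and lnG: "ln G = expectation (\<lambda>\<omega>. ln (X \<omega>))"
    by (auto simp: G_def geom_mean_def)
  have c: "0 < c"
    using \<epsilon> by (simp add: c_def)
  have pos: "0 < X \<omega>" if "\<omega> \<in> space M" for \<omega>
    using X(1) that by (simp add: positive_rv_def)
  have f: "f \<omega> = X \<omega> / G - 1 - ln (X \<omega> / G)" if "\<omega> \<in> space M" for \<omega>
    using pos[OF that] G by (simp add: f_def ln_div)
  have f_ge: "(sqrt (X \<omega> / G) - 1)\<^sup>2 \<le> f \<omega>" if "\<omega> \<in> space M" for \<omega>
    using sqrt_deviation_le[of "X \<omega> / G"] pos[OF that] G by (simp add: f[OF that])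
  have int_f: "integrable M f"
    unfolding f_def using X(2,3) by simp
  \<comment> \<open>The logarithmic terms cancel because ln G is the mean of ln X.\<close>
  have Ef: "expectation f = arith_mean M X / G - 1"
    unfolding f_def using X(2,3) by (simp add: lnG arith_mean_def prob_space)
  have "prob {\<omega> \<in> space M. \<epsilon> \<le> \<bar>X \<omega> / G - 1\<bar>} \<le> prob {\<omega> \<in> space M. c \<le> f \<omega>}"
  proof (rule finite_measure_mono)
    show "{\<omega> \<in> space M. c \<le> f \<omega>} \<in> events"
      using int_f by measurable
    show "{\<omega> \<in> space M. \<epsilon> \<le> \<bar>X \<omega> / G - 1\<bar>} \<subseteq> {\<omega> \<in> space M. c \<le> f \<omega>}"
    proof clarify
      fix \<omega> assume \<omega>: "\<omega> \<in> space M" and "\<epsilon> \<le> \<bar>X \<omega> / G - 1\<bar>"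
      then have "c \<le> (sqrt (X \<omega> / G) - 1)\<^sup>2"
        unfolding c_def using pos[OF \<omega>] G \<epsilon> by (intro sqrt_deviation_ge) simp_all
      then show "c \<le> f \<omega>"
        using f_ge[OF \<omega>] by simp
    qed
  qed
  also have "\<dots> \<le> expectation f / c"
  proof (rule integral_Markov_inequality_measure[OF int_f sets.empty_sets _ c])
    show "AE \<omega> in M. 0 \<le> f \<omega>"
      using order_trans[OF zero_le_power2 f_ge] by (rule AE_I2)
  qed
  finally show ?thesis
    by (simp add: Ef G_def c_def)
qed

text \<open>The Markov bound (A/G - 1) / c is below \<eta> once A/G - 1 < c \<eta>, which dictates
  the witness \<open>c * \<eta>\<close>; it involves only \<epsilon> and \<eta>.\<close>

lemma ex_admissible_delta:
  assumes "0 < \<epsilon>" "0 < \<eta>"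
  shows "\<exists>\<delta>>0. admissible_delta TYPE('a) \<epsilon> \<eta> \<delta>"
proof (intro exI conjI)
  define c where "c = (sqrt (1 + \<epsilon>) - 1)\<^sup>2"
  have c: "0 < c"
    using assms(1) by (simp add: c_def)
  then show "0 < c * \<eta>"
    using assms(2) by simp
  show "admissible_delta TYPE('a) \<epsilon> \<eta> (c * \<eta>)"
    unfolding admissible_delta_def
  proof (intro allI impI, elim conjE)
    fix M :: "'a measure" and X
    assume "prob_space M" "positive_rv M X" "integrable M X" "integrable M (\<lambda>\<omega>. ln (X \<omega>))"
      and lt: "arith_mean M X / geom_mean M X < 1 + c * \<eta>"
    then have "measure M {\<omega> \<in> space M. \<epsilon> \<le> \<bar>X \<omega> / geom_mean M X - 1\<bar>}
        \<le> (arith_mean M X / geom_mean M X - 1) / c"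
      using prob_space.prob_deviation_geom_mean_le assms(1) unfolding c_def by blast
    also have "\<dots> \<le> \<eta>"
      using lt c by (simp add: pos_divide_le_eq mult.commute)
    finally show "measure M {\<omega> \<in> space M. \<epsilon> \<le> \<bar>X \<omega> / geom_mean M X - 1\<bar>} \<le> \<eta>" .
  qed
qed

text \<open>Both means and the deviation probability depend only on the law of X, and this law lives
  on the reals. Hence the transfer works for any given \<delta>, not just for the one constructed
  above.\<close>

lemma admissible_delta_real_imp:
  assumes adm: "admissible_delta TYPE(real) \<epsilon> \<eta> \<delta>"
  shows "admissible_delta TYPE('a) \<epsilon> \<eta> \<delta>"
  unfolding admissible_delta_def
proof (intro allI impI, elim conjE)
  fix M :: "'a measure" and X
  assume M: "prob_space M" and X: "positive_rv M X" "integrable M X" "integrable M (\<lambda>\<omega>. ln (X \<omega>))"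
    and gt: "1 < arith_mean M X / geom_mean M X"
    and lt: "arith_mean M X / geom_mean M X < 1 + \<delta>"
  define N where "N = distr M borel X"
  (* positive_rv demands positivity on the whole sample space, which is now all of the reals *)
  define Z :: "real \<Rightarrow> real" where "Z x = (if 0 < x then x else 1)" for x
  have [measurable]: "X \<in> borel_measurable M"
    using X(1) by (simp add: positive_rv_def)
  have [measurable]: "Z \<in> borel_measurable borel"
    unfolding Z_def by measurable
  \<comment> \<open>\<open>Z\<close> is the identity on the range of X, so integrals of
    \<open>Z\<close> and ln \<open>Z\<close> under the law \<open>N\<close> are those of X and ln X
    under \<open>M\<close>.\<close>
  have ZX: "Z (X \<omega>) = X \<omega>" if "\<omega> \<in> space M" for \<omega>
    using X(1) that by (simp add: Z_def positive_rv_def)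
  have N: "prob_space N"
    unfolding N_def using M by (intro prob_space.prob_space_distr) auto
  have Z: "positive_rv N Z"
    by (auto simp: positive_rv_def N_def Z_def)
  have int: "integrable N Z" "integrable N (\<lambda>x. ln (Z x))"
    using X(2,3) by (simp_all add: N_def integrable_distr_eq ZX cong: Bochner_Integration.integrable_cong)
  have am: "arith_mean N Z = arith_mean M X"
    by (simp add: arith_mean_def N_def integral_distr ZX cong: Bochner_Integration.integral_cong)
  have gm: "geom_mean N Z = geom_mean M X"
    by (simp add: geom_mean_def N_def integral_distr ZX cong: Bochner_Integration.integral_cong)
  \<comment> \<open>The deviation event of \<open>Z\<close>, written with the geometric mean of X,
    which is equal by \<open>gm\<close>; its preimage under X is the deviation event of X.\<close>
  let ?D = "{x \<in> space N. \<epsilon> \<le> \<bar>Z x / geom_mean M X - 1\<bar>}"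
  have "?D \<in> sets borel"
    unfolding N_def by simp
  then have "measure N ?D = measure M (X -` ?D \<inter> space M)"
    unfolding N_def by (intro measure_distr) auto
  moreover have "X -` ?D \<inter> space M = {\<omega> \<in> space M. \<epsilon> \<le> \<bar>X \<omega> / geom_mean M X - 1\<bar>}"
    by (auto simp: ZX N_def)
  moreover have "measure N ?D \<le> \<eta>"
    using adm[unfolded admissible_delta_def, rule_format, of N Z] N Z int gt lt
    by (simp add: am gm)
  ultimately show "measure M {\<omega> \<in> space M. \<epsilon> \<le> \<bar>X \<omega> / geom_mean M X - 1\<bar>} \<le> \<eta>"
    by simp
qed

theorem mainTheorem2:
  "\<forall>\<epsilon>>0. \<forall>\<eta>>0.
     (\<exists>\<delta>>0. admissible_delta TYPE(real) \<epsilon> \<eta> \<delta>) \<and>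
     (\<forall>\<delta>>0. admissible_delta TYPE(real) \<epsilon> \<eta> \<delta> \<longrightarrow> admissible_delta TYPE('a) \<epsilon> \<eta> \<delta>)"
  using ex_admissible_delta admissible_delta_real_imp by blast

end
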